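(* Let $0\le k<K$, let $M_k$ be any optimal cardinality-$k$ matching and write $A_k=A(M_k)$. Let $M_{k+1}$ be any optimal cardinality-$(k+1)$ matching with $A(M_{k+1})=A_k\cup\{x,y\}$, where $x\notin A_k$ is a source atom and $y\notin A_k$ is a target atom. Then $x$ and $y$ are consecutive in the cyclic ordering of the inactive set $A_k^c$.
   Context: Fix $L>0$, $w>0$ and integers $n,m\ge 1$. The circle is $\mathbb{S}^1_L=\mathbb{R}/L\mathbb{Z}$, with points represented by coordinates in $[0,L)$ and geodesic distance $d(x,y)=\min\{|x-y|,\,L-|x-y|\}$. Let $x_1,\dots,x_n$ (source atoms) and $y_1,\dots,y_m$ (target atoms) be points of the circle, all $N=n+m$ of them pairwise distinct, each carrying the same mass $w$. Put $K=\min(n,m)$. A matching $M$ is a set of pairs $(x_i,y_j)$ in which no atom appears in more than one pair; its cost is $w\sum_{(x_i,y_j)\in M}d(x_i,y_j)$. For $0\le k\le K$, $C_k^\circ$ is the minimum cost over all matchings with $|M|=k$, and a matching with $|M|=k$ and cost $C_k^\circ$ is called an optimal cardinality-$k$ matching. The active set $A(M)$ is the set of all source and target atoms incident to a pair of $M$. For a set $A$ of atoms, $A^c$ denotes the set of the atoms among $x_1,\dots,x_n,y_1,\dots,y_m$ not in $A$ (the inactive set). Two atoms of $A^c$ are consecutive in the cyclic ordering of $A^c$ if at least one of the two open circular arcs joining them contains no atom of $A^c$. *)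

theory Defs
  imports Complex_Main
begin

text \<open>
  The circle \<open>\<real>/L\<int>\<close> is represented by the coordinates in \<open>{0..<L}\<close>.
  Atoms are identified with their positions, which the theorem assumes pairwise distinct.
\<close>

definition circ_dist :: "real \<Rightarrow> real \<Rightarrow> real \<Rightarrow> real" where
  "circ_dist L a b = min \<bar>a - b\<bar> (L - \<bar>a - b\<bar>)"

definition is_matching :: "real set \<Rightarrow> real set \<Rightarrow> (real \<times> real) set \<Rightarrow> bool" where
  "is_matching X Y M \<longleftrightarrow>
     M \<subseteq> X \<times> Y \<and> pairwise (\<lambda>e e'. {fst e, snd e} \<inter> {fst e', snd e'} = {}) M"

definition matching_cost :: "real \<Rightarrow> real \<Rightarrow> (real \<times> real) set \<Rightarrow> real" where
  "matching_cost L w M = w * (\<Sum>(a, b)\<in>M. circ_dist L a b)"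

text \<open>
  The minimum ranges over a finite set, nonempty whenever \<open>X\<close> and \<open>Y\<close> are finite and disjoint
  and \<open>k \<le> min (card X) (card Y)\<close>; outside these conditions the value is not meaningful.
\<close>

definition opt_cost :: "real \<Rightarrow> real \<Rightarrow> real set \<Rightarrow> real set \<Rightarrow> nat \<Rightarrow> real" where
  "opt_cost L w X Y k = Min {matching_cost L w M | M. is_matching X Y M \<and> card M = k}"

definition optimal_matching ::
  "real \<Rightarrow> real \<Rightarrow> real set \<Rightarrow> real set \<Rightarrow> nat \<Rightarrow> (real \<times> real) set \<Rightarrow> bool" where
  "optimal_matching L w X Y k M \<longleftrightarrow>
     is_matching X Y M \<and> card M = k \<and> matching_cost L w M = opt_cost L w X Y k"

definition active_set :: "(real \<times> real) set \<Rightarrow> real set" where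
  "active_set M = fst ` M \<union> snd ` M"

text \<open>
  The open arc traversed from \<open>a\<close> to \<open>b\<close> in the direction of increasing coordinate, for distinct
  \<open>a\<close> and \<open>b\<close> in \<open>{0..<L}\<close>; when \<open>b < a\<close> it passes through the coordinate \<open>0\<close>.
  The two open arcs joining \<open>a\<close> and \<open>b\<close> are \<open>open_arc L a b\<close> and \<open>open_arc L b a\<close>.
\<close>

definition open_arc :: "real \<Rightarrow> real \<Rightarrow> real \<Rightarrow> real set" where
  "open_arc L a b = (if a < b then {a<..<b} else {a<..<L} \<union> {0..<b})"

definition cyclically_consecutive :: "real \<Rightarrow> real set \<Rightarrow> real \<Rightarrow> real \<Rightarrow> bool" where
  "cyclically_consecutive L S a b \<longleftrightarrow>
     a \<in> S \<and> b \<in> S \<and> a \<noteq> b \<and> (open_arc L a b \<inter> S = {} \<or> open_arc L b a \<inter> S = {})"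

end

theory Submission
  imports Defs
begin

text \<open>
  An optimal matching \<open>M\<close> never routes a pair over an inactive atom, since one end of that pair could
  be replaced by the inactive atom at a strictly smaller cost. If \<open>x\<close> and \<open>y\<close> were not consecutive,
  some inactive atoms \<open>s\<close> and \<open>t\<close> would separate them, and these would be inactive for both \<open>M\<close> and
  \<open>M'\<close>. Then no pair of \<open>M\<close> or \<open>M'\<close> joins the two arcs between \<open>s\<close> and \<open>t\<close>, so that in each arc
  both matchings use as many sources as targets. But the arc containing \<open>x\<close> has exactly one more
  active source under \<open>M'\<close> than under \<open>M\<close>, and equally many active targets.
\<close>

lemma is_matching_inj_on:
  assumes "is_matching X Y M"
  shows "inj_on fst M" and "inj_on snd M"
proof -
  have "e = e'" if "e \<in> M" "e' \<in> M" "{fst e, snd e} \<inter> {fst e', snd e'} \<noteq> {}" for e e'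
    using that assms pairwiseD[of _ M e e'] unfolding is_matching_def by meson
  then show "inj_on fst M" "inj_on snd M"
    by (simp_all add: inj_on_def)
qed

lemma is_matching_fst_image:
  assumes "is_matching X Y M" "X \<inter> Y = {}"
  shows "fst ` M = active_set M \<inter> X"
proof -
  have "fst ` M \<subseteq> X" "snd ` M \<subseteq> Y"
    using assms(1) by (auto simp: is_matching_def)
  then show ?thesis
    using assms(2) unfolding active_set_def by blast
qed

lemma is_matching_snd_image:
  assumes "is_matching X Y M" "X \<inter> Y = {}"
  shows "snd ` M = active_set M \<inter> Y"
proof -
  have "fst ` M \<subseteq> X" "snd ` M \<subseteq> Y"
    using assms(1) by (auto simp: is_matching_def)
  then show ?thesis
    using assms(2) unfolding active_set_def by blast
qed

lemma finite_is_matching: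
  assumes "finite X" "finite Y" "is_matching X Y M"
  shows "finite M"
  using assms unfolding is_matching_def by (meson finite_SigmaI finite_subset)

lemma optimal_matching_le:
  assumes "finite X" "finite Y" "optimal_matching L w X Y k M"
    and "is_matching X Y M'" "card M' = k"
  shows "matching_cost L w M \<le> matching_cost L w M'"
proof -
  let ?C = "{matching_cost L w M | M. is_matching X Y M \<and> card M = k}"
  have "?C \<subseteq> matching_cost L w ` Pow (X \<times> Y)"
    unfolding is_matching_def by blast
  then have "finite ?C"
    using assms(1,2) by (meson finite_Pow_iff finite_SigmaI finite_imageI finite_subset)
  then have "opt_cost L w X Y k \<le> matching_cost L w M'"
    unfolding opt_cost_def using assms(4,5) by (intro Min_le) auto
  then show ?thesis
    using assms(3) by (simp add: optimal_matching_def)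
qed

text \<open>Removing \<open>{a, b}\<close> from the forbidden atoms lets the new pair reuse an end
  of the deleted one. Below, one end is always kept and the other moves to an inactive atom.\<close>

lemma is_matching_exchange:
  assumes m: "is_matching X Y M" and ab: "(a, b) \<in> M"
    and "a' \<in> X" "b' \<in> Y"
    and "a' \<notin> active_set M - {a, b}" "b' \<notin> active_set M - {a, b}"
  shows "is_matching X Y (insert (a', b') (M - {(a, b)}))"
proof -
  have pw: "pairwise (\<lambda>e e'. {fst e, snd e} \<inter> {fst e', snd e'} = {}) M"
    using m by (simp add: is_matching_def)
  have "{a', b'} \<inter> {fst e, snd e} = {}" if e: "e \<in> M - {(a, b)}" for e
  proof -
    have "{a, b} \<inter> {fst e, snd e} = {}"
      using pairwiseD[OF pw ab, of e] e by auto
    moreover have "fst e \<in> active_set M" "snd e \<in> active_set M"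
      using e by (auto simp: active_set_def)
    ultimately show ?thesis
      using assms(5,6) by auto
  qed
  moreover from this have "{fst e, snd e} \<inter> {a', b'} = {}" if "e \<in> M - {(a, b)}" for e
    using that by blast
  moreover have "pairwise (\<lambda>e e'. {fst e, snd e} \<inter> {fst e', snd e'} = {}) (M - {(a, b)})"
    using pw by (rule pairwise_subset) blast
  ultimately show ?thesis
    using m assms(3,4) unfolding is_matching_def pairwise_insert by auto
qed

text \<open>Both matchings share the pairs of \<open>?R\<close>, so optimality reduces to comparing
  the two exchanged pairs. As \<open>e\<close> is new, the exchange preserves the
  cardinality.\<close>

lemma optimal_matching_exchange:
  assumes "finite X" "finite Y" "w > 0" and opt: "optimal_matching L w X Y k M"
    and ab: "(a, b) \<in> M"
    and M': "is_matching X Y (insert e (M - {(a, b)}))" and e: "e \<notin> M"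
  shows "circ_dist L a b \<le> circ_dist L (fst e) (snd e)"
proof -
  let ?R = "M - {(a, b)}"
  have fin: "finite M"
    using opt by (auto simp: optimal_matching_def intro: finite_is_matching[OF assms(1,2)])
  \<comment> \<open>This prevents truncation in \<open>card M - 1\<close>, the cardinality of
    \<open>?R\<close>.\<close>
  have "card M > 0"
    using fin ab by (auto simp: card_gt_0_iff)
  then have "card (insert e ?R) = k"
    using fin e ab opt by (simp add: optimal_matching_def)
  then have "matching_cost L w M \<le> matching_cost L w (insert e ?R)"
    by (rule optimal_matching_le[OF assms(1,2) opt M'])
  moreover have "matching_cost L w M =
      w * (circ_dist L a b + (\<Sum>(a, b)\<in>?R. circ_dist L a b))"
    using sum.remove[OF fin ab, of "\<lambda>(a, b). circ_dist L a b"] by (simp add: matching_cost_def)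
  moreover have "matching_cost L w (insert e ?R) =
      w * (circ_dist L (fst e) (snd e) + (\<Sum>(a, b)\<in>?R. circ_dist L a b))"
    using fin e by (simp add: matching_cost_def split_beta)
  ultimately show ?thesis
    using \<open>w > 0\<close> by simp
qed

text \<open>An inactive target can only replace the target end of a pair, so \<open>a\<close> is
  kept; the next lemma is the mirror case for sources.\<close>

lemma optimal_matching_inactive_target:
  assumes "finite X" "finite Y" "X \<inter> Y = {}" "w > 0"
    and opt: "optimal_matching L w X Y k M"
    and ab: "(a, b) \<in> M" and s: "s \<in> Y - active_set M"
  shows "circ_dist L a b \<le> circ_dist L a s"
proof -
  have m: "is_matching X Y M"
    using opt by (simp add: optimal_matching_def)
  have "s \<notin> fst ` M" "s \<notin> snd ` M" "a \<in> X" "a \<noteq> s"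
    using s m ab \<open>X \<inter> Y = {}\<close> by (auto simp: active_set_def is_matching_def)
  then have "(a, s) \<notin> M"
    by force
  moreover have "is_matching X Y (insert (a, s) (M - {(a, b)}))"
    using is_matching_exchange[OF m ab, of "a" "s"] m ab s
    by (auto simp: is_matching_def active_set_def)
  ultimately show ?thesis
    using optimal_matching_exchange[OF assms(1,2,4) opt ab, of "(a, s)"] by simp
qed

lemma optimal_matching_inactive_source:
  assumes "finite X" "finite Y" "X \<inter> Y = {}" "w > 0"
    and opt: "optimal_matching L w X Y k M"
    and ab: "(a, b) \<in> M" and s: "s \<in> X - active_set M"
  shows "circ_dist L a b \<le> circ_dist L s b"
proof -
  have m: "is_matching X Y M"
    using opt by (simp add: optimal_matching_def)
  have "s \<notin> fst ` M" "s \<notin> snd ` M" "b \<in> Y" "b \<noteq> s"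
    using s m ab \<open>X \<inter> Y = {}\<close> by (auto simp: active_set_def is_matching_def)
  then have "(s, b) \<notin> M"
    by force
  moreover have "is_matching X Y (insert (s, b) (M - {(a, b)}))"
    using is_matching_exchange[OF m ab, of "s" "b"] m ab s
    by (auto simp: is_matching_def active_set_def)
  ultimately show ?thesis
    using optimal_matching_exchange[OF assms(1,2,4) opt ab, of "(s, b)"] by simp
qed

lemma circ_dist_commute: "circ_dist L a b = circ_dist L b a"
  by (simp add: circ_dist_def abs_minus_commute)

text \<open>Here the direct arc from \<open>a\<close> to \<open>b\<close> is a geodesic, and
  \<open>r\<close> cuts it into two shorter arcs.\<close>

lemma circ_dist_less_inner:
  assumes "a < r" "r < b" "2 * (b - a) \<le> L"
  shows "circ_dist L a r < circ_dist L a b" "circ_dist L r b < circ_dist L a b"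
  using assms by (simp_all add: circ_dist_def min_def)

text \<open>Here the arc through the coordinate 0, of length \<open>L - (b - a)\<close>, is a
  geodesic and \<open>r\<close> lies inside it.\<close>

lemma circ_dist_less_outer:
  assumes "0 \<le> a" "a < b" "b < L" "0 \<le> r" "r < L" "r < a \<or> b < r" "L \<le> 2 * (b - a)"
  shows "circ_dist L a r < circ_dist L a b" "circ_dist L r b < circ_dist L a b"
proof -
  have "circ_dist L a b = L - (b - a)"
    using assms by (simp add: circ_dist_def min_def)
  then show "circ_dist L a r < circ_dist L a b" "circ_dist L r b < circ_dist L a b"
    using assms by (auto simp: circ_dist_def min_less_iff_disj)
qed

text \<open>Each of the two arcs joining \<open>a\<close> and \<open>b\<close> contains
  \<open>s\<close> or \<open>t\<close>, hence so does a geodesic. Both inequalities are stated for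
  the same \<open>r\<close>, because whether \<open>r\<close> is a source or a target will decide
  which end it replaces.\<close>

lemma circ_dist_separated:
  assumes "a \<in> {0..<L}" "b \<in> {0..<L}" "s \<in> {0..<L}" "t \<in> {0..<L}"
    and "a \<noteq> s" "a \<noteq> t" "b \<noteq> s" "b \<noteq> t" "s < t"
    and "a \<in> {s<..<t} \<longleftrightarrow> b \<notin> {s<..<t}"
  shows "\<exists>r\<in>{s, t}. circ_dist L a r < circ_dist L a b \<and> circ_dist L r b < circ_dist L a b"
  using assms
\<comment> \<open>The claim is symmetric in \<open>a\<close> and \<open>b\<close>: swapping them
  swaps the two inequalities.\<close>
proof (induction a b rule: linorder_wlog)
  case (le a b)
  then have "a < b"
    by (metis order_le_less)
  \<comment> \<open>One separator lies on the direct arc, the other on the arc through 0; the length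
    \<open>b - a\<close> decides which one is used.\<close>
  have "\<exists>r\<in>{s, t}. a < r \<and> r < b" "\<exists>r\<in>{s, t}. r < a \<or> b < r"
    using le by auto
  then obtain r r' where r: "r \<in> {s, t}" "a < r" "r < b"
    and r': "r' \<in> {s, t}" "r' < a \<or> b < r'"
    by metis
  show ?case
  proof (cases "2 * (b - a) \<le> L")
    case True
    then show ?thesis
      using circ_dist_less_inner[OF r(2,3)] r(1) by blast
  next
    case False
    have "0 \<le> r'" "r' < L"
      using r'(1) le by auto
    then have "circ_dist L a r' < circ_dist L a b" "circ_dist L r' b < circ_dist L a b"
      using circ_dist_less_outer[of a b L r'] r'(2) le \<open>a < b\<close> False by simp_all
    then show ?thesis
      using r'(1) by blast
  qed
next
  case (sym a b)
  then show ?case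
    by (metis circ_dist_commute)
qed

lemma optimal_matching_not_separated:
  assumes "finite X" "finite Y" "X \<inter> Y = {}" "w > 0" "X \<union> Y \<subseteq> {0..<L}"
    and opt: "optimal_matching L w X Y k M"
    and s: "s \<in> X \<union> Y - active_set M" and t: "t \<in> X \<union> Y - active_set M" and "s < t"
    and ab: "(a, b) \<in> M"
  shows "a \<in> {s<..<t} \<longleftrightarrow> b \<in> {s<..<t}"
proof (rule ccontr)
  assume sep: "\<not> ?thesis"
  have "a \<in> X" "b \<in> Y"
    using opt ab by (auto simp: optimal_matching_def is_matching_def)
  moreover have "a \<in> active_set M" "b \<in> active_set M"
    using ab by (force simp: active_set_def)+
  ultimately have "\<exists>r\<in>{s, t}. circ_dist L a r < circ_dist L a b \<and> circ_dist L r b < circ_dist L a b"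
    using assms(5) s t \<open>s < t\<close> sep by (intro circ_dist_separated) auto
  then obtain r where "r \<in> X \<union> Y - active_set M"
    and r: "circ_dist L a r < circ_dist L a b" "circ_dist L r b < circ_dist L a b"
    using s t by blast
  then consider "r \<in> X - active_set M" | "r \<in> Y - active_set M"
    by blast
  then show False
    using optimal_matching_inactive_source[OF assms(1-4) opt ab]
      optimal_matching_inactive_target[OF assms(1-4) opt ab] r
    by cases (meson not_less)+
qed

text \<open>Both sides count the pairs that lie inside \<open>I\<close>, since each projection is
  injective on a matching.\<close>

lemma is_matching_balanced:
  assumes m: "is_matching X Y M" and I: "\<And>a b. (a, b) \<in> M \<Longrightarrow> a \<in> I \<longleftrightarrow> b \<in> I"
  shows "card (fst ` M \<inter> I) = card (snd ` M \<inter> I)"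
proof -
  let ?N = "{e \<in> M. fst e \<in> I}"
  have "fst ` M \<inter> I = fst ` ?N"
    by auto
  moreover have "snd ` M \<inter> I = snd ` ?N"
    using I by force
  moreover have "inj_on fst ?N" "inj_on snd ?N"
    using is_matching_inj_on[OF m] by (auto intro: inj_on_subset)
  ultimately show ?thesis
    by (simp add: card_image)
qed

text \<open>Take one point of \<open>S\<close> from each open arc joining \<open>x\<close> and
  \<open>y\<close>. Ordering these two points by coordinate turns one of the arcs between them into
  a plain interval, which avoids wrapping around 0.\<close>

lemma not_consecutive_separated:
  assumes "x \<in> S" "y \<in> S" "x \<noteq> y" "\<not> cyclically_consecutive L S x y"
  obtains s t where "s \<in> S - {x, y}" "t \<in> S - {x, y}" "s < t"
    and "x \<in> {s<..<t} \<longleftrightarrow> y \<notin> {s<..<t}"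
proof -
  obtain s t where "s \<in> S" "t \<in> S" "s \<in> open_arc L x y" "t \<in> open_arc L y x"
    using assms unfolding cyclically_consecutive_def by blast
  then show thesis
    using that[of s t] that[of t s] \<open>x \<noteq> y\<close>
    by (cases "s < t") (auto simp: open_arc_def split: if_splits)
qed

theorem theorem2:
  fixes L w :: real and n m k :: nat and p q :: "nat \<Rightarrow> real"
    and X Y :: "real set" and M M' :: "(real \<times> real) set" and x y :: real
  assumes "L > 0" and "w > 0" and "n \<ge> 1" and "m \<ge> 1"
    and "\<forall>i\<in>{1..n}. p i \<in> {0..<L}" and "\<forall>j\<in>{1..m}. q j \<in> {0..<L}"
    and "inj_on p {1..n}" and "inj_on q {1..m}"
    and "\<forall>i\<in>{1..n}. \<forall>j\<in>{1..m}. p i \<noteq> q j"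
    and "X = p ` {1..n}" and "Y = q ` {1..m}"
    and "k < min n m"
    and "optimal_matching L w X Y k M"
    and "optimal_matching L w X Y (k + 1) M'"
    and "x \<in> X" and "x \<notin> active_set M"
    and "y \<in> Y" and "y \<notin> active_set M"
    and "active_set M' = active_set M \<union> {x, y}"
  shows "cyclically_consecutive L ((X \<union> Y) - active_set M) x y"
proof (rule ccontr)
  let ?S = "X \<union> Y - active_set M"
  assume nc: "\<not> cyclically_consecutive L ?S x y"
  have fin: "finite X" "finite Y" and disj: "X \<inter> Y = {}" and XY: "X \<union> Y \<subseteq> {0..<L}"
    using assms by auto
  have m: "is_matching X Y M" and m': "is_matching X Y M'"
    using assms(13,14) by (auto simp: optimal_matching_def)
  have xy: "x \<in> ?S" "y \<in> ?S" "x \<noteq> y" "x \<notin> Y" "y \<notin> X"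
    using assms(15-18) disj by auto
  obtain s t where st: "s \<in> ?S - {x, y}" "t \<in> ?S - {x, y}" "s < t"
    and sep: "x \<in> {s<..<t} \<longleftrightarrow> y \<notin> {s<..<t}"
    using not_consecutive_separated[OF xy(1-3) nc] .
  let ?I = "{s<..<t}"
  have "a \<in> ?I \<longleftrightarrow> b \<in> ?I" if "(a, b) \<in> M" for a b
    using optimal_matching_not_separated[OF fin disj assms(2) XY assms(13) _ _ st(3) that] st by blast
  then have bal: "card (fst ` M \<inter> ?I) = card (snd ` M \<inter> ?I)"
    by (rule is_matching_balanced[OF m])
  \<comment> \<open>Since \<open>s\<close> and \<open>t\<close> differ from \<open>x\<close> and
    \<open>y\<close>, they are inactive for \<open>M'\<close> too.\<close>
  have "a \<in> ?I \<longleftrightarrow> b \<in> ?I" if "(a, b) \<in> M'" for a b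
    using optimal_matching_not_separated[OF fin disj assms(2) XY assms(14) _ _ st(3) that] st assms(19)
    by blast
  then have bal': "card (fst ` M' \<inter> ?I) = card (snd ` M' \<inter> ?I)"
    by (rule is_matching_balanced[OF m'])
  have "fst ` M' = insert x (fst ` M)" "snd ` M' = insert y (snd ` M)"
    using is_matching_fst_image[OF m disj] is_matching_fst_image[OF m' disj]
      is_matching_snd_image[OF m disj] is_matching_snd_image[OF m' disj] assms(15,17,19) xy
    by auto
  moreover have "x \<notin> fst ` M" "y \<notin> snd ` M" "finite M"
    using assms(16,18) finite_is_matching[OF fin m] by (auto simp: active_set_def)
  \<comment> \<open>Exactly one of \<open>x\<close> and \<open>y\<close> lies in \<open>?I\<close>,
    so passing from \<open>M\<close> to \<open>M'\<close> raises exactly one side of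
    \<open>bal\<close> by 1. Deleting the simp rule keeps membership in \<open>?I\<close> intact, so
    that \<open>sep\<close> can rewrite it.\<close>
  ultimately show False
    using bal bal' sep by (cases "x \<in> ?I") (simp_all add: Int_insert_left del: greaterThanLessThan_iff)
qed

end
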